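(* Let $t_0<t_1$ be real numbers, let $X\neq\{0\}$ be a Banach space, let $\alpha>0$ and $1<p<\infty$. Then $$\frac{(t_1-t_0)^\alpha}{\Gamma(\alpha+1)[\alpha p+1]^{1/p}}\le N_{\alpha,p}.$$
   Context: $L^p(t_0,t_1;X)$ is the Bochner-Lebesgue space on $[t_0,t_1]$ with its usual norm. For $\alpha>0$, $J^\alpha_{t_0,t}$ is the bounded linear operator from $L^p(t_0,t_1;X)$ into itself sending $f$ to the (a.e. defined) function $t\mapsto J^\alpha_{t_0,t}f(t):=\frac{1}{\Gamma(\alpha)}\int_{t_0}^t(t-s)^{\alpha-1}f(s)\,ds$ (Bochner integral). $N_{\alpha,p}$ denotes the operator norm of $J^\alpha_{t_0,t}$ from $L^p(t_0,t_1;X)$ into itself. *)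

theory Defs
  imports "HOL-Analysis.Analysis"
begin

(* The library's Bochner integral requires a second countable codomain. The Banach space here
   need not be separable, so measurability is strong measurability (almost everywhere limit of
   simple functions) and the integral is the usual limit of integrals of simple functions;
   apart from the measurability condition, this is the shape of has_bochner_integral. *)

definition strongly_measurable :: "'a measure \<Rightarrow> ('a \<Rightarrow> 'b::real_normed_vector) \<Rightarrow> bool" where
  "strongly_measurable M f \<longleftrightarrow>
     (\<exists>s :: nat \<Rightarrow> 'a \<Rightarrow> 'b. (\<forall>i. Bochner_Integration.simple_bochner_integrable M (s i)) \<and>
        (AE x in M. (\<lambda>i. s i x) \<longlonglongrightarrow> f x))"

definition has_Bochner_integral ::
  "'a measure \<Rightarrow> ('a \<Rightarrow> 'b::real_normed_vector) \<Rightarrow> 'b \<Rightarrow> bool" where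
  "has_Bochner_integral M f x \<longleftrightarrow>
     strongly_measurable M f \<and>
     (\<exists>s :: nat \<Rightarrow> 'a \<Rightarrow> 'b. (\<forall>i. Bochner_Integration.simple_bochner_integrable M (s i)) \<and>
        (\<lambda>i. \<integral>\<^sup>+ y. ennreal (norm (f y - s i y)) \<partial>M) \<longlonglongrightarrow> 0 \<and>
        (\<lambda>i. Bochner_Integration.simple_bochner_integral M (s i)) \<longlonglongrightarrow> x)"

definition Bochner_integral :: "'a measure \<Rightarrow> ('a \<Rightarrow> 'b::real_normed_vector) \<Rightarrow> 'b" where
  "Bochner_integral M f =
     (if \<exists>x. has_Bochner_integral M f x then THE x. has_Bochner_integral M f x else 0)"

(* Elements of the space L^p are represented by functions. Lp_norm is then a seminorm whose
   kernel is the almost everywhere vanishing functions, and the norm of an operator that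
   respects almost everywhere equality is the same as on the quotient. *)

definition Lp_set :: "'a measure \<Rightarrow> real \<Rightarrow> ('a \<Rightarrow> 'b::real_normed_vector) set" where
  "Lp_set M p = {f. strongly_measurable M f \<and> integrable M (\<lambda>x. norm (f x) powr p)}"

definition Lp_norm :: "'a measure \<Rightarrow> real \<Rightarrow> ('a \<Rightarrow> 'b::real_normed_vector) \<Rightarrow> real" where
  "Lp_norm M p f = (LINT x|M. norm (f x) powr p) powr (1 / p)"

definition Lp_opnorm ::
  "'a measure \<Rightarrow> real \<Rightarrow> (('a \<Rightarrow> 'b::real_normed_vector) \<Rightarrow> 'a \<Rightarrow> 'b) \<Rightarrow> real" where
  "Lp_opnorm M p T = (SUP f\<in>{f \<in> Lp_set M p. Lp_norm M p f \<le> 1}. Lp_norm M p (T f))"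

definition RL_integral ::
  "real \<Rightarrow> real \<Rightarrow> (real \<Rightarrow> 'b::real_normed_vector) \<Rightarrow> real \<Rightarrow> 'b" where
  "RL_integral \<alpha> t0 f t =
     (1 / Gamma \<alpha>) *\<^sub>R
       Bochner_integral (lebesgue_on {t0..t}) (\<lambda>s. (t - s) powr (\<alpha> - 1) *\<^sub>R f s)"

end

theory Submission
  imports Defs
begin

text \<open>
  The lower bound is the value of the operator at a constant function. If \<open>f\<close> is constantly \<open>e\<close>,
  then \<open>J\<^sup>\<alpha> f (t) = (t - t0)\<^sup>\<alpha> / \<Gamma>(\<alpha> + 1) \<cdot> e\<close> (\<open>RL_integral_const\<close>). Take
  \<open>norm e = (t1 - t0) powr (- 1 / p)\<close>, which gives \<open>f\<close> norm 1; the integral of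
  \<open>(t - t0) powr (\<alpha> * p)\<close> over \<open>[t0, t1]\<close> is \<open>(t1 - t0) powr (\<alpha> * p + 1) / (\<alpha> * p + 1)\<close>,
  and the \<open>p\<close>-th root of what results is exactly the claimed constant.

  The substance lies in a different place. The operator norm is a supremum of real numbers, and it
  dominates the value at one function only if the set of values is bounded. So the theorem needs
  the boundedness of \<open>J\<^sup>\<alpha>\<close> on \<open>L\<^sup>p\<close>, though with any constant
  (\<open>bdd_above_RL_integral_unit_ball\<close>). Pointwise, \<open>norm (J\<^sup>\<alpha> f (t))\<close> is at most
  the integral of the kernel times \<open>norm f\<close>, by the norm inequality for the Bochner integral
  (\<open>norm_Bochner_integral_le\<close>). The kernel has mass at most \<open>K = (t1 - t0) powr \<alpha> / \<alpha>\<close> in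
  each of its two variables. As in the Schur test, the first of these bounds passes the power \<open>p\<close>
  into the integral (\<open>nn_integral_weighted_le_powr\<close>, a weak form of Hoelder's inequality), and the
  second one together with Tonelli's theorem bounds the integral over \<open>t\<close>
  (\<open>nn_integral_RL_integral_powr_le\<close>). All estimates are made with integrals in \<open>[0, \<infinity>]\<close>,
  where they also cover the points \<open>t\<close> at which the Bochner integral does not exist: its default
  value there is 0, which satisfies every upper bound of this kind.
\<close>

section \<open>The Bochner integral in non-separable spaces\<close>

text \<open>
  Without second countability, \<open>f - s\<close> need not be Borel measurable. Its norm still agrees almost
  everywhere with a measurable function, because it is an almost everywhere limit of norms of simple
  functions. This is all that additivity of the nonnegative integral requires.
\<close>

lemma strongly_measurable_norm_diff_AE_eq:
  fixes f :: "'a \<Rightarrow> 'b::real_normed_vector"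
  assumes f: "strongly_measurable M f" and s: "Bochner_Integration.simple_bochner_integrable M s"
  obtains g :: "'a \<Rightarrow> ennreal" where "g \<in> borel_measurable M"
    "AE x in M. ennreal (norm (f x - s x)) = g x"
proof -
  obtain u where u: "\<And>i. Bochner_Integration.simple_bochner_integrable M (u i)"
    and lim: "AE x in M. (\<lambda>i. u i x) \<longlonglongrightarrow> f x"
    using f unfolding strongly_measurable_def by blast
  define v where "v i x = ennreal (norm (u i x - s x))" for i x
  have "Bochner_Integration.simple_bochner_integrable M (\<lambda>x. norm (u i x - s x))" for i
    using simple_bochner_integrable_compose2[of "\<lambda>x y. norm (x - y)", OF _ u s] by simp
  then have [measurable]: "v i \<in> borel_measurable M" for i
    unfolding v_def
    by (auto intro: borel_measurable_simple_function measurable_compose[OF _ measurable_ennreal]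
        elim: simple_bochner_integrable.cases)
  show ?thesis
  proof (rule that[of "\<lambda>x. liminf (\<lambda>i. v i x)"])
    show "(\<lambda>x. liminf (\<lambda>i. v i x)) \<in> borel_measurable M"
      by measurable
    show "AE x in M. ennreal (norm (f x - s x)) = liminf (\<lambda>i. v i x)"
      using lim
    proof eventually_elim
      case (elim x)
      have "(\<lambda>i. v i x) \<longlonglongrightarrow> ennreal (norm (f x - s x))"
        unfolding v_def by (intro tendsto_intros elim)
      then show ?case
        by (simp add: lim_imp_Liminf)
    qed
  qed
qed

text \<open>
  This one estimate yields both facts about the Bochner integral that are needed: uniqueness of the
  value, when \<open>s\<close> and \<open>t\<close> run through two approximating sequences, and the norm inequality, when
  \<open>t = 0\<close>.
\<close>

lemma simple_bochner_integral_diff_le: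
  fixes f :: "'a \<Rightarrow> 'b::real_normed_vector"
  assumes f: "strongly_measurable M f"
    and s: "Bochner_Integration.simple_bochner_integrable M s"
    and t: "Bochner_Integration.simple_bochner_integrable M t"
  shows "ennreal (norm (Bochner_Integration.simple_bochner_integral M s
        - Bochner_Integration.simple_bochner_integral M t))
    \<le> (\<integral>\<^sup>+ x. norm (f x - s x) \<partial>M) + (\<integral>\<^sup>+ x. norm (f x - t x) \<partial>M)"
proof -
  obtain g where [measurable]: "g \<in> borel_measurable M"
    and g: "AE x in M. ennreal (norm (f x - s x)) = g x"
    using strongly_measurable_norm_diff_AE_eq[OF f s] .
  obtain h where [measurable]: "h \<in> borel_measurable M"
    and h: "AE x in M. ennreal (norm (f x - t x)) = h x"
    using strongly_measurable_norm_diff_AE_eq[OF f t] .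
  have diff: "Bochner_Integration.simple_bochner_integrable M (\<lambda>x. s x - t x)"
    using simple_bochner_integrable_compose2[of "(-)", OF _ s t] by simp
  have norm_diff: "Bochner_Integration.simple_bochner_integrable M (\<lambda>x. norm (s x - t x))"
    using simple_bochner_integrable_compose2[of "\<lambda>x y. norm (x - y)", OF _ s t] by simp
  have "ennreal (norm (Bochner_Integration.simple_bochner_integral M s
        - Bochner_Integration.simple_bochner_integral M t))
      = norm (Bochner_Integration.simple_bochner_integral M (\<lambda>x. s x - t x))"
    using s t by (simp add: simple_bochner_integral_diff)
  also have "\<dots> \<le> Bochner_Integration.simple_bochner_integral M (\<lambda>x. norm (s x - t x))"
    by (intro ennreal_leI simple_bochner_integral_norm_bound diff)
  also have "\<dots> = (\<integral>\<^sup>+ x. norm (s x - t x) \<partial>M)"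
    by (intro simple_bochner_integral_eq_nn_integral norm_diff) simp
  also have "\<dots> \<le> (\<integral>\<^sup>+ x. g x + h x \<partial>M)"
    using g h
  proof (intro nn_integral_mono_AE, eventually_elim)
    case (elim x)
    have "norm (s x - t x) \<le> norm (f x - s x) + norm (f x - t x)"
      by (metis dual_order.refl norm_diff_triangle_le norm_minus_commute)
    then have "ennreal (norm (s x - t x)) \<le> ennreal (norm (f x - s x)) + ennreal (norm (f x - t x))"
      by (metis ennreal_leI ennreal_plus norm_ge_zero)
    then show ?case
      using elim by simp
  qed
  also have "\<dots> = (\<integral>\<^sup>+ x. g x \<partial>M) + (\<integral>\<^sup>+ x. h x \<partial>M)"
    by (rule nn_integral_add) auto
  also have "\<dots> = (\<integral>\<^sup>+ x. norm (f x - s x) \<partial>M) + (\<integral>\<^sup>+ x. norm (f x - t x) \<partial>M)"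
    using nn_integral_cong_AE[OF g] nn_integral_cong_AE[OF h] by simp
  finally show ?thesis .
qed

lemma has_Bochner_integral_unique:
  assumes x: "has_Bochner_integral M f x" and y: "has_Bochner_integral M f y"
  shows "x = y"
proof -
  have f: "strongly_measurable M f"
    using x unfolding has_Bochner_integral_def by blast
  obtain s where s: "\<And>i. Bochner_Integration.simple_bochner_integrable M (s i)"
    "(\<lambda>i. \<integral>\<^sup>+ z. ennreal (norm (f z - s i z)) \<partial>M) \<longlonglongrightarrow> 0"
    "(\<lambda>i. Bochner_Integration.simple_bochner_integral M (s i)) \<longlonglongrightarrow> x"
    using x unfolding has_Bochner_integral_def by blast
  obtain t where t: "\<And>i. Bochner_Integration.simple_bochner_integrable M (t i)"
    "(\<lambda>i. \<integral>\<^sup>+ z. ennreal (norm (f z - t i z)) \<partial>M) \<longlonglongrightarrow> 0"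
    "(\<lambda>i. Bochner_Integration.simple_bochner_integral M (t i)) \<longlonglongrightarrow> y"
    using y unfolding has_Bochner_integral_def by blast
  have "(\<lambda>i. ennreal (norm (Bochner_Integration.simple_bochner_integral M (s i)
      - Bochner_Integration.simple_bochner_integral M (t i)))) \<longlonglongrightarrow> ennreal (norm (x - y))"
    by (intro tendsto_intros s t)
  moreover have "(\<lambda>i. (\<integral>\<^sup>+ z. ennreal (norm (f z - s i z)) \<partial>M)
      + (\<integral>\<^sup>+ z. ennreal (norm (f z - t i z)) \<partial>M)) \<longlonglongrightarrow> 0 + 0"
    by (intro tendsto_add s t)
  ultimately have "ennreal (norm (x - y)) \<le> 0 + 0"
    by (rule LIMSEQ_le) (use simple_bochner_integral_diff_le[OF f s(1) t(1)] in auto)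
  then show ?thesis
    by simp
qed

lemma Bochner_integral_eq:
  "has_Bochner_integral M f x \<Longrightarrow> Bochner_integral M f = x"
  unfolding Bochner_integral_def using has_Bochner_integral_unique by (metis the_equality)

text \<open>
  The integral, if it exists, is a limit of simple integrals whose norms are bounded by comparison
  with the simple function 0; otherwise the default value 0 satisfies the bound.
\<close>

lemma norm_Bochner_integral_le:
  fixes f :: "'a \<Rightarrow> 'b::real_normed_vector"
  shows "ennreal (norm (Bochner_integral M f)) \<le> (\<integral>\<^sup>+ x. norm (f x) \<partial>M)"
proof (cases "\<exists>x. has_Bochner_integral M f x")
  case True
  then obtain x where x: "has_Bochner_integral M f x"
    by blast
  then obtain s where f: "strongly_measurable M f"
    and s: "\<And>i. Bochner_Integration.simple_bochner_integrable M (s i)"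
      "(\<lambda>i. \<integral>\<^sup>+ z. ennreal (norm (f z - s i z)) \<partial>M) \<longlonglongrightarrow> 0"
      "(\<lambda>i. Bochner_Integration.simple_bochner_integral M (s i)) \<longlonglongrightarrow> x"
    unfolding has_Bochner_integral_def by blast
  have zero: "Bochner_Integration.simple_bochner_integrable M (\<lambda>_. 0 :: 'b)"
    by (auto intro: simple_bochner_integrable.intros)
  have zero_integral: "Bochner_Integration.simple_bochner_integral M (\<lambda>_. 0 :: 'b) = 0"
    unfolding Bochner_Integration.simple_bochner_integral_def by (intro sum.neutral) auto
  have "(\<lambda>i. ennreal (norm (Bochner_Integration.simple_bochner_integral M (s i)))) \<longlonglongrightarrow> ennreal (norm x)"
    by (intro tendsto_intros s)
  moreover have "(\<lambda>i. (\<integral>\<^sup>+ z. ennreal (norm (f z - s i z)) \<partial>M) + (\<integral>\<^sup>+ z. norm (f z) \<partial>M))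
      \<longlonglongrightarrow> 0 + (\<integral>\<^sup>+ z. norm (f z) \<partial>M)"
    by (intro tendsto_intros s)
  moreover have "\<exists>N. \<forall>i\<ge>N. ennreal (norm (Bochner_Integration.simple_bochner_integral M (s i)))
      \<le> (\<integral>\<^sup>+ z. ennreal (norm (f z - s i z)) \<partial>M) + (\<integral>\<^sup>+ z. norm (f z) \<partial>M)"
    using simple_bochner_integral_diff_le[OF f s(1) zero] by (simp add: zero_integral)
  ultimately have "ennreal (norm x) \<le> 0 + (\<integral>\<^sup>+ z. norm (f z) \<partial>M)"
    by (rule LIMSEQ_le)
  then show ?thesis
    using Bochner_integral_eq[OF x] by simp
next
  case False
  then show ?thesis
    by (simp add: Bochner_integral_def)
qed

text \<open>
  A scalar function \<open>k\<close> is approximated by simple functions that it dominates up to the factor 2;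
  multiplied by \<open>e\<close>, they approximate \<open>k e\<close>. Functions of this form are the only ones whose
  Bochner integral has to be computed.
\<close>

lemma has_Bochner_integral_scaleR_left:
  fixes k :: "'a \<Rightarrow> real" and e :: "'b::real_normed_vector"
  assumes k: "integrable M k"
  shows "has_Bochner_integral M (\<lambda>x. k x *\<^sub>R e) ((LINT x|M. k x) *\<^sub>R e)"
proof -
  have [measurable]: "k \<in> borel_measurable M" and fin: "(\<integral>\<^sup>+ x. norm (k x) \<partial>M) < \<infinity>"
    using k by (auto simp: integrable_iff_bounded)
  obtain s where sf: "\<And>i. simple_function M (s i)"
    and lim: "\<And>x. x \<in> space M \<Longrightarrow> (\<lambda>i. s i x) \<longlonglongrightarrow> k x"
    and bound: "\<And>i x. x \<in> space M \<Longrightarrow> norm (s i x) \<le> 2 * norm (k x)"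
    using borel_measurable_implies_sequence_metric[of k M 0] by simp metis
  have [measurable]: "s i \<in> borel_measurable M" for i
    by (rule borel_measurable_simple_function[OF sf])
  have dom: "integrable M (\<lambda>x. 2 * norm (k x))"
    using k by simp
  have int_s: "integrable M (s i)" for i
    by (rule Bochner_Integration.integrable_bound[OF dom]) (use bound in auto)
  have s: "Bochner_Integration.simple_bochner_integrable M (s i)" for i
    using int_s[of i] by (intro simple_bochner_integrableI_bounded sf) (auto simp: integrable_iff_bounded)
  have se: "Bochner_Integration.simple_bochner_integrable M (\<lambda>x. s i x *\<^sub>R e)" for i
    using simple_bochner_integrable_compose2[of "\<lambda>x y. x *\<^sub>R e", OF _ s s] by simp
  have lin: "linear (\<lambda>r::real. r *\<^sub>R e)"
    by (simp add: linear_iff scaleR_left_distrib)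
  have L1: "(\<lambda>i. \<integral>\<^sup>+ x. ennreal (norm (k x - s i x)) \<partial>M) \<longlonglongrightarrow> 0"
    by (rule nn_integral_dominated_convergence_norm[where w="\<lambda>x. 2 * norm (k x)"])
       (use lim bound fin in \<open>auto simp: ennreal_mult nn_integral_cmult ennreal_mult_less_top\<close>)
  have "(\<lambda>i. LINT x|M. s i x) \<longlonglongrightarrow> (LINT x|M. k x)"
    by (rule integral_dominated_convergence[OF _ _ dom]) (use lim bound in auto)
  then have int_lim: "(\<lambda>i. (LINT x|M. s i x) *\<^sub>R e) \<longlonglongrightarrow> (LINT x|M. k x) *\<^sub>R e"
    by (intro tendsto_intros)
  have "strongly_measurable M (\<lambda>x. k x *\<^sub>R e)"
    unfolding strongly_measurable_def
    by (rule exI[of _ "\<lambda>i x. s i x *\<^sub>R e"]) (use se lim in \<open>auto intro!: tendsto_intros\<close>)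
  moreover have "(\<lambda>i. \<integral>\<^sup>+ x. ennreal (norm (k x *\<^sub>R e - s i x *\<^sub>R e)) \<partial>M) \<longlonglongrightarrow> 0"
  proof -
    have "(\<integral>\<^sup>+ x. ennreal (norm (k x *\<^sub>R e - s i x *\<^sub>R e)) \<partial>M)
        = ennreal (norm e) * (\<integral>\<^sup>+ x. ennreal (norm (k x - s i x)) \<partial>M)" for i
      by (subst nn_integral_cmult[symmetric])
         (auto simp: scaleR_left_diff_distrib[symmetric] ennreal_mult'' mult.commute)
    moreover have "(\<lambda>i. ennreal (norm e) * (\<integral>\<^sup>+ x. ennreal (norm (k x - s i x)) \<partial>M))
        \<longlonglongrightarrow> ennreal (norm e) * 0"
      by (intro ennreal_tendsto_cmult L1) simp
    ultimately show ?thesis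
      by simp
  qed
  moreover have "(\<lambda>i. Bochner_Integration.simple_bochner_integral M (\<lambda>x. s i x *\<^sub>R e))
      \<longlonglongrightarrow> (LINT x|M. k x) *\<^sub>R e"
    using int_lim
    by (simp add: simple_bochner_integral_linear[OF lin s] simple_bochner_integrable_eq_integral[OF s])
  ultimately show ?thesis
    unfolding has_Bochner_integral_def using se by (intro conjI exI[of _ "\<lambda>i x. s i x *\<^sub>R e"]) auto
qed

section \<open>The fractional kernel\<close>

lemma has_integral_powr_shift:
  fixes a :: real
  assumes "a > -1" "c \<le> d"
  shows "((\<lambda>x. (x - c) powr a) has_integral (d - c) powr (a + 1) / (a + 1)) {c..d}"
  using has_integral_affinity'[of "\<lambda>x. x powr a" _ 0 "d - c" 1 "- c"]
    has_integral_powr_from_0[of a "d - c"] assms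
  by simp

lemma has_integral_powr_reflect:
  fixes a :: real
  assumes "a > -1" "c \<le> d"
  shows "((\<lambda>x. (d - x) powr a) has_integral (d - c) powr (a + 1) / (a + 1)) {c..d}"
  using has_integral_powr_shift[of a "- d" "- c"] assms
    has_integral_reflect_real[of "\<lambda>x. (d - x) powr a" _ d c]
  by (simp add: add.commute)

text \<open>
  The restriction \<open>s \<in> [t0, t]\<close> is part of the kernel, so that integrals over the variable interval
  become integrals over the whole line and Tonelli's theorem applies.
\<close>

definition RL_kernel :: "real \<Rightarrow> real \<Rightarrow> real \<Rightarrow> real \<Rightarrow> ennreal" where
  "RL_kernel \<alpha> t0 t s = ennreal ((t - s) powr (\<alpha> - 1)) * indicator {t0..t} s"

lemma borel_measurable_RL_kernel [measurable]:
  assumes [measurable]: "f \<in> borel_measurable M" "g \<in> borel_measurable M"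
  shows "(\<lambda>x. RL_kernel \<alpha> t0 (f x) (g x)) \<in> borel_measurable M"
  unfolding RL_kernel_def indicator_def of_bool_def atLeastAtMost_iff by measurable

lemma nn_integral_RL_kernel:
  assumes "\<alpha> > 0" "t0 \<le> t"
  shows "(\<integral>\<^sup>+ s. RL_kernel \<alpha> t0 t s \<partial>lborel) = ennreal ((t - t0) powr \<alpha> / \<alpha>)"
  unfolding RL_kernel_def
  using nn_integral_has_integral_lebesgue'[OF _ has_integral_powr_reflect[of "\<alpha> - 1" t0 t]] assms
  by simp

lemma nn_integral_RL_kernel_swapped_le:
  assumes "\<alpha> > 0" "t0 \<le> t1"
  shows "(\<integral>\<^sup>+ t. RL_kernel \<alpha> t0 t s * indicator {t0..t1} t \<partial>lborel)
    \<le> ennreal ((t1 - t0) powr \<alpha> / \<alpha>) * indicator {t0..t1} s"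
proof (cases "s \<in> {t0..t1}")
  case True
  have "(\<integral>\<^sup>+ t. RL_kernel \<alpha> t0 t s * indicator {t0..t1} t \<partial>lborel)
      = (\<integral>\<^sup>+ t. ennreal ((t - s) powr (\<alpha> - 1)) * indicator {s..t1} t \<partial>lborel)"
    using True by (intro nn_integral_cong) (auto simp: RL_kernel_def indicator_def)
  also have "\<dots> = ennreal ((t1 - s) powr \<alpha> / \<alpha>)"
    using nn_integral_has_integral_lebesgue'[OF _ has_integral_powr_shift[of "\<alpha> - 1" s t1]] assms True
    by simp
  also have "\<dots> \<le> ennreal ((t1 - t0) powr \<alpha> / \<alpha>)"
    using assms True by (intro ennreal_leI divide_right_mono powr_mono2) auto
  finally show ?thesis
    using True by simp
next
  case False
  then have "RL_kernel \<alpha> t0 t s * indicator {t0..t1} t = 0" for t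
    by (auto simp: RL_kernel_def indicator_def)
  then show ?thesis
    by (simp only: nn_integral_const) simp
qed

lemma norm_RL_integral_le:
  assumes "\<alpha> > 0"
  shows "ennreal (norm (RL_integral \<alpha> t0 f t))
    \<le> ennreal (1 / Gamma \<alpha>) * (\<integral>\<^sup>+ s. RL_kernel \<alpha> t0 t s * ennreal (norm (f s)) \<partial>lborel)"
proof -
  have "ennreal (norm (RL_integral \<alpha> t0 f t)) = ennreal (1 / Gamma \<alpha>) *
      ennreal (norm (Bochner_integral (lebesgue_on {t0..t}) (\<lambda>s. (t - s) powr (\<alpha> - 1) *\<^sub>R f s)))"
    using Gamma_real_pos[of \<alpha>] assms by (subst ennreal_mult'[symmetric]) (auto simp: RL_integral_def)
  also have "\<dots> \<le> ennreal (1 / Gamma \<alpha>) *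
      (\<integral>\<^sup>+ s. norm ((t - s) powr (\<alpha> - 1) *\<^sub>R f s) \<partial>lebesgue_on {t0..t})"
    by (intro mult_left_mono norm_Bochner_integral_le) simp
  also have "(\<integral>\<^sup>+ s. norm ((t - s) powr (\<alpha> - 1) *\<^sub>R f s) \<partial>lebesgue_on {t0..t})
      = (\<integral>\<^sup>+ s. RL_kernel \<alpha> t0 t s * ennreal (norm (f s)) \<partial>lborel)"
    by (subst nn_integral_restrict_space)
       (auto intro!: nn_integral_cong simp: nn_integral_completion RL_kernel_def ennreal_mult' mult_ac)
  finally show ?thesis .
qed

section \<open>Boundedness on L^p\<close>

text \<open>
  For \<open>a > l\<close> the power \<open>(a / l) powr (1 - p)\<close> is at most 1. Choosing \<open>l\<close> well replaces
  Hoelder's inequality at the cost of a worse constant.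
\<close>

lemma le_scale_plus_powr:
  fixes a l p :: real
  assumes "0 \<le> a" "0 < l" "1 \<le> p"
  shows "a \<le> l + l powr (1 - p) * a powr p"
proof (cases "a \<le> l")
  case True
  then show ?thesis
    by (simp add: add_increasing2)
next
  case False
  then have "a > 0"
    using assms by simp
  have "a = a powr (1 - p) * a powr p"
    using \<open>a > 0\<close> by (simp add: powr_add[symmetric])
  also have "\<dots> \<le> l powr (1 - p) * a powr p"
    using False assms by (intro mult_right_mono powr_mono2') auto
  finally show ?thesis
    using assms by linarith
qed

text \<open>
  Hoelder's inequality for the weight \<open>w\<close>, up to constants: integrate \<open>le_scale_plus_powr\<close> with
  \<open>l = (g + 1) powr (1 / p)\<close>. The summand 1 keeps \<open>l\<close> positive when \<open>g = 0\<close>. The function \<open>F\<close> is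
  a measurable representative of \<open>h powr p\<close>; for a function that is only Lebesgue measurable it
  can be chosen Borel measurable.
\<close>

lemma nn_integral_weighted_le_powr:
  fixes h :: "'a \<Rightarrow> real" and w F :: "'a \<Rightarrow> ennreal"
  assumes [measurable]: "w \<in> borel_measurable M" "F \<in> borel_measurable M"
    and F: "AE x in M. ennreal (h x powr p) = F x"
    and h: "\<And>x. 0 \<le> h x"
    and K: "(\<integral>\<^sup>+ x. w x \<partial>M) \<le> ennreal K" "0 \<le> K"
    and g: "(\<integral>\<^sup>+ x. w x * F x \<partial>M) = ennreal g" "0 \<le> g"
    and p: "1 \<le> p"
  shows "(\<integral>\<^sup>+ x. w x * ennreal (h x) \<partial>M) \<le> ennreal ((K + 1) * (g + 1) powr (1 / p))"
proof -
  define l where "l = (g + 1) powr (1 / p)"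
  have l: "l > 0"
    using g by (simp add: l_def)
  have "l powr p = g + 1"
    using g p by (simp add: l_def powr_powr)
  then have scale: "l powr (1 - p) * (g + 1) = l"
    using l by (simp flip: powr_add add: \<open>l powr p = g + 1\<close>[symmetric])
  have "(\<integral>\<^sup>+ x. w x * ennreal (h x) \<partial>M)
      \<le> (\<integral>\<^sup>+ x. ennreal l * w x + ennreal (l powr (1 - p)) * (w x * F x) \<partial>M)"
    using F
  proof (intro nn_integral_mono_AE, eventually_elim)
    case (elim x)
    have "ennreal (h x) \<le> ennreal (l + l powr (1 - p) * h x powr p)"
      by (intro ennreal_leI le_scale_plus_powr h l p)
    also have "\<dots> = ennreal l + ennreal (l powr (1 - p)) * F x"
      using l by (subst ennreal_plus) (auto simp: ennreal_mult' simp flip: elim(2))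
    finally have "w x * ennreal (h x) \<le> w x * (ennreal l + ennreal (l powr (1 - p)) * F x)"
      by (intro mult_left_mono) auto
    then show ?case
      by (simp add: distrib_left mult_ac)
  qed
  also have "\<dots> = ennreal l * (\<integral>\<^sup>+ x. w x \<partial>M) + ennreal (l powr (1 - p)) * (\<integral>\<^sup>+ x. w x * F x \<partial>M)"
    by (simp add: nn_integral_add nn_integral_cmult)
  also have "\<dots> \<le> ennreal l * ennreal K + ennreal (l powr (1 - p)) * ennreal (g + 1)"
    using g by (intro add_mono mult_left_mono K) (auto intro: ennreal_leI)
  also have "\<dots> = ennreal (l * K + l powr (1 - p) * (g + 1))"
    using l K g by (subst ennreal_plus) (auto simp: ennreal_mult' simp del: ennreal_plus)
  also have "l * K + l powr (1 - p) * (g + 1) = (K + 1) * l"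
    using scale by (simp add: algebra_simps)
  finally show ?thesis
    by (simp add: l_def)
qed

text \<open>
  The Schur test for the fractional kernel. The measure space is finite, so the additive 1 that comes
  from \<open>nn_integral_weighted_le_powr\<close> contributes only the term \<open>t1 - t0\<close>.
\<close>

lemma nn_integral_RL_integral_powr_le:
  fixes f :: "real \<Rightarrow> 'b::real_normed_vector"
  assumes \<alpha>: "\<alpha> > 0" and p: "1 \<le> p" and t: "t0 \<le> t1"
    and K: "K = (t1 - t0) powr \<alpha> / \<alpha>"
    and [measurable]: "(\<lambda>x. norm (f x) powr p) \<in> borel_measurable (lebesgue_on {t0..t1})"
  shows "(\<integral>\<^sup>+ t. norm (RL_integral \<alpha> t0 f t) powr p \<partial>lebesgue_on {t0..t1})
    \<le> ennreal (((K + 1) / Gamma \<alpha>) powr p) *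
       (ennreal K * (\<integral>\<^sup>+ s. norm (f s) powr p \<partial>lebesgue_on {t0..t1}) + ennreal (t1 - t0))"
proof -
  have K0: "0 \<le> K"
    using \<alpha> K by simp
  have Gamma_pos: "Gamma \<alpha> > 0"
    using \<alpha> by (rule Gamma_real_pos)
  define C where "C = ennreal (((K + 1) / Gamma \<alpha>) powr p)"
  define f0 where "f0 s = (if s \<in> {t0..t1} then f s else 0)" for s
  have "(\<lambda>x. ennreal (norm (f x) powr p)) \<in> borel_measurable (lebesgue_on {t0..t1})"
    by measurable
  then have "(\<lambda>x. ennreal (norm (f x) powr p) * indicator {t0..t1} x) \<in> borel_measurable lebesgue"
    by (subst (asm) borel_measurable_restrict_space_iff_ennreal) auto
  also have "(\<lambda>x. ennreal (norm (f x) powr p) * indicator {t0..t1} x)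
      = (\<lambda>x. ennreal (norm (f0 x) powr p))"
    using p by (auto simp: f0_def indicator_def)
  finally have "(\<lambda>x. ennreal (norm (f0 x) powr p)) \<in> borel_measurable lebesgue" .
  \<comment> \<open>A Borel representative makes the double integral one over the product of two copies of
    \<open>lborel\<close>, where Tonelli's theorem is available.\<close>
  then obtain F where F_meas: "F \<in> borel_measurable lborel"
    and F: "AE x in lborel. ennreal (norm (f0 x) powr p) = F x"
    using completion_ex_borel_measurable by blast
  note [measurable] = F_meas
  define G where "G t = (\<integral>\<^sup>+ s. RL_kernel \<alpha> t0 t s * F s \<partial>lborel)" for t
  have [measurable]: "G \<in> borel_measurable borel"
    unfolding G_def by measurable
  have pointwise: "ennreal (norm (RL_integral \<alpha> t0 f t) powr p) \<le> C * (G t + 1)"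
    if t: "t \<in> {t0..t1}" for t
  proof (cases "G t")
    case (real g)
    have "(\<integral>\<^sup>+ s. RL_kernel \<alpha> t0 t s \<partial>lborel) \<le> ennreal K"
      using t \<alpha> by (auto simp: nn_integral_RL_kernel K intro!: ennreal_leI divide_right_mono powr_mono2)
    then have "(\<integral>\<^sup>+ s. RL_kernel \<alpha> t0 t s * ennreal (norm (f0 s)) \<partial>lborel)
        \<le> ennreal ((K + 1) * (g + 1) powr (1 / p))"
      using real K0 p F by (intro nn_integral_weighted_le_powr[where F=F]) (auto simp: G_def)
    also have "(\<integral>\<^sup>+ s. RL_kernel \<alpha> t0 t s * ennreal (norm (f0 s)) \<partial>lborel)
        = (\<integral>\<^sup>+ s. RL_kernel \<alpha> t0 t s * ennreal (norm (f s)) \<partial>lborel)"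
      using t by (intro nn_integral_cong) (auto simp: RL_kernel_def f0_def indicator_def)
    finally have "ennreal (norm (RL_integral \<alpha> t0 f t))
        \<le> ennreal (1 / Gamma \<alpha>) * ennreal ((K + 1) * (g + 1) powr (1 / p))"
      by (intro order.trans[OF norm_RL_integral_le[OF \<alpha>]] mult_left_mono) auto
    also have "\<dots> = ennreal ((K + 1) / Gamma \<alpha> * (g + 1) powr (1 / p))"
      using Gamma_pos by (subst ennreal_mult'[symmetric]) auto
    finally have "norm (RL_integral \<alpha> t0 f t) \<le> (K + 1) / Gamma \<alpha> * (g + 1) powr (1 / p)"
      using K0 Gamma_pos by (subst (asm) ennreal_le_iff) auto
    then have "norm (RL_integral \<alpha> t0 f t) powr p \<le> ((K + 1) / Gamma \<alpha> * (g + 1) powr (1 / p)) powr p"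
      using p by (intro powr_mono2) auto
    also have "\<dots> = ((K + 1) / Gamma \<alpha>) powr p * (g + 1)"
      using p K0 Gamma_pos real by (subst powr_mult) (simp_all add: powr_powr)
    finally have "ennreal (norm (RL_integral \<alpha> t0 f t) powr p) \<le> ennreal (((K + 1) / Gamma \<alpha>) powr p * (g + 1))"
      by (rule ennreal_leI)
    also have "\<dots> = C * (G t + 1)"
      using real by (simp add: C_def ennreal_mult')
    finally show ?thesis .
  next
    \<comment> \<open>Here the right-hand side is infinite, as the constant is positive.\<close>
    case top
    have "C > 0"
      using K0 Gamma_pos by (simp add: C_def)
    then show ?thesis
      using top by (simp add: ennreal_mult_top)
  qed
  have "(\<integral>\<^sup>+ t. norm (RL_integral \<alpha> t0 f t) powr p \<partial>lebesgue_on {t0..t1})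
      \<le> (\<integral>\<^sup>+ t. C * (G t + 1) \<partial>lebesgue_on {t0..t1})"
    using pointwise by (intro nn_integral_mono) auto
  also have "\<dots> = (\<integral>\<^sup>+ t. C * (G t * indicator {t0..t1} t + indicator {t0..t1} t) \<partial>lborel)"
    by (subst nn_integral_restrict_space)
       (auto intro!: nn_integral_cong simp: nn_integral_completion indicator_def)
  also have "\<dots> = C * ((\<integral>\<^sup>+ t. G t * indicator {t0..t1} t \<partial>lborel) + ennreal (t1 - t0))"
    using t by (simp add: nn_integral_cmult nn_integral_add)
  also have "(\<integral>\<^sup>+ t. G t * indicator {t0..t1} t \<partial>lborel)
      = (\<integral>\<^sup>+ t. \<integral>\<^sup>+ s. F s * (RL_kernel \<alpha> t0 t s * indicator {t0..t1} t) \<partial>lborel \<partial>lborel)"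
    unfolding G_def by (subst nn_integral_multc[symmetric]) (auto simp: mult_ac)
  also have "\<dots> = (\<integral>\<^sup>+ s. \<integral>\<^sup>+ t. F s * (RL_kernel \<alpha> t0 t s * indicator {t0..t1} t) \<partial>lborel \<partial>lborel)"
    by (rule lborel_pair.Fubini'[symmetric]) measurable
  also have "\<dots> = (\<integral>\<^sup>+ s. F s * (\<integral>\<^sup>+ t. RL_kernel \<alpha> t0 t s * indicator {t0..t1} t \<partial>lborel) \<partial>lborel)"
    by (subst nn_integral_cmult) auto
  also have "\<dots> \<le> (\<integral>\<^sup>+ s. F s * (ennreal K * indicator {t0..t1} s) \<partial>lborel)"
    unfolding K using \<alpha> t by (intro nn_integral_mono mult_left_mono nn_integral_RL_kernel_swapped_le) auto
  also have "\<dots> = ennreal K * (\<integral>\<^sup>+ s. F s * indicator {t0..t1} s \<partial>lborel)"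
    by (subst nn_integral_cmult[symmetric]) (auto simp: mult_ac)
  also have "(\<integral>\<^sup>+ s. F s * indicator {t0..t1} s \<partial>lborel)
      = (\<integral>\<^sup>+ s. ennreal (norm (f s) powr p) * indicator {t0..t1} s \<partial>lborel)"
    using F by (intro nn_integral_cong_AE) (auto elim!: eventually_mono simp: f0_def indicator_def)
  also have "\<dots> = (\<integral>\<^sup>+ s. norm (f s) powr p \<partial>lebesgue_on {t0..t1})"
    by (subst nn_integral_restrict_space) (auto simp: nn_integral_completion)
  finally show ?thesis
    by (simp add: C_def add_mono mult_left_mono)
qed

text \<open>
  If the norm of \<open>J\<^sup>\<alpha> f\<close> to the power \<open>p\<close> were not integrable, its integral would be 0 by default,
  so a bound on the integral in \<open>[0, \<infinity>]\<close> suffices in all cases.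
\<close>

lemma bdd_above_RL_integral_unit_ball:
  assumes \<alpha>: "\<alpha> > 0" and p: "1 \<le> p" and t: "t0 \<le> t1"
  defines "M \<equiv> lebesgue_on {t0..t1}"
  shows "bdd_above ((\<lambda>f. Lp_norm M p (RL_integral \<alpha> t0 f)) `
    {f :: real \<Rightarrow> 'b::real_normed_vector. f \<in> Lp_set M p \<and> Lp_norm M p f \<le> 1})"
proof -
  define K where "K = (t1 - t0) powr \<alpha> / \<alpha>"
  define B where "B = ((K + 1) / Gamma \<alpha>) powr p * (K + (t1 - t0))"
  have K0: "0 \<le> K"
    using \<alpha> by (simp add: K_def)
  have B0: "0 \<le> B"
    using t K0 by (simp add: B_def)
  have "Lp_norm M p (RL_integral \<alpha> t0 f) \<le> B powr (1 / p)"
    if f: "f \<in> Lp_set M p" "Lp_norm M p f \<le> 1" for f :: "real \<Rightarrow> 'b"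
  proof -
    have int: "integrable M (\<lambda>x. norm (f x) powr p)"
      using f by (simp add: Lp_set_def)
    have int0: "0 \<le> (LINT x|M. norm (f x) powr p)"
      by simp
    have "(LINT x|M. norm (f x) powr p) = ((LINT x|M. norm (f x) powr p) powr (1 / p)) powr p"
      using p int0 by (simp add: powr_powr)
    also have "\<dots> \<le> 1 powr p"
      using f p by (intro powr_mono2) (auto simp: Lp_norm_def)
    finally have le1: "(\<integral>\<^sup>+ x. norm (f x) powr p \<partial>M) \<le> 1"
      using nn_integral_eq_integral[OF int] by simp
    have "(\<integral>\<^sup>+ t. norm (RL_integral \<alpha> t0 f t) powr p \<partial>M) \<le> ennreal (((K + 1) / Gamma \<alpha>) powr p) *
       (ennreal K * (\<integral>\<^sup>+ s. norm (f s) powr p \<partial>M) + ennreal (t1 - t0))"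
      using nn_integral_RL_integral_powr_le[OF \<alpha> p t K_def, of f] borel_measurable_integrable[OF int]
      by (simp add: M_def)
    also have "\<dots> \<le> ennreal (((K + 1) / Gamma \<alpha>) powr p) * (ennreal K * 1 + ennreal (t1 - t0))"
      by (intro mult_left_mono add_mono le1) auto
    also have "\<dots> = ennreal B"
      using K0 t by (simp add: B_def ennreal_mult' del: ennreal_plus flip: ennreal_plus)
    finally have "(LINT t|M. norm (RL_integral \<alpha> t0 f t) powr p) \<le> B"
      by (intro integral_real_bounded B0)
    then show ?thesis
      unfolding Lp_norm_def using p by (intro powr_mono2) auto
  qed
  then show ?thesis
    by (intro bdd_aboveI[of _ "B powr (1 / p)"]) auto
qed

section \<open>The constant test function\<close>

lemma integrable_lebesgue_on_has_integral:
  fixes f :: "real \<Rightarrow> real"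
  assumes f: "(f has_integral I) {a..b}" and nonneg: "\<And>x. x \<in> {a..b} \<Longrightarrow> 0 \<le> f x"
  shows "integrable (lebesgue_on {a..b}) f" "(LINT x|lebesgue_on {a..b}. f x) = I"
proof -
  have "f absolutely_integrable_on {a..b}"
    using f nonneg by (intro nonnegative_absolutely_integrable_1) auto
  then show int: "integrable (lebesgue_on {a..b}) f"
    by (simp add: integrable_restrict_space set_integrable_def)
  show "(LINT x|lebesgue_on {a..b}. f x) = I"
    using has_integral_integral_lebesgue_on[OF int] f by (auto dest: has_integral_unique)
qed

text \<open>
  The kernel integrates to \<open>(t - t0) powr \<alpha> / \<alpha>\<close>, and \<open>\<alpha> \<Gamma>(\<alpha>) = \<Gamma>(\<alpha> + 1)\<close>.
\<close>

lemma RL_integral_const: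
  assumes "\<alpha> > 0" "t0 \<le> t"
  shows "RL_integral \<alpha> t0 (\<lambda>_. e) t = ((t - t0) powr \<alpha> / Gamma (\<alpha> + 1)) *\<^sub>R e"
proof -
  have "((\<lambda>s. (t - s) powr (\<alpha> - 1)) has_integral (t - t0) powr \<alpha> / \<alpha>) {t0..t}"
    using has_integral_powr_reflect[of "\<alpha> - 1" t0 t] assms by simp
  note int = integrable_lebesgue_on_has_integral[OF this]
  show ?thesis
    using Bochner_integral_eq[OF has_Bochner_integral_scaleR_left[OF int(1), of e]] int(2)
      Gamma_plus1[of \<alpha>] assms
    by (force simp: RL_integral_def mult.commute)
qed

lemma const_in_Lp_set:
  "(\<lambda>_. e) \<in> Lp_set (lebesgue_on {a..b::real}) p"
proof -
  have fin: "emeasure (lebesgue_on {a..b}) (space (lebesgue_on {a..b})) < \<infinity>"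
    by (simp add: emeasure_restrict_space emeasure_lborel_Icc_eq)
  then have "integrable (lebesgue_on {a..b}) (\<lambda>_. c)" for c :: real
    by (intro finite_measure.integrable_const finite_measureI) simp
  moreover have "Bochner_Integration.simple_bochner_integrable (lebesgue_on {a..b}) (\<lambda>_. e)"
    using fin by (cases "e = 0") (simp_all add: simple_bochner_integrable.simps atLeastAtMost_def atLeast_def atMost_def Int_def)
  ultimately show ?thesis
    by (auto simp: Lp_set_def strongly_measurable_def)
qed

theorem theorem44:
  fixes t0 t1 \<alpha> p :: real
  assumes "t0 < t1"
    and "\<exists>x :: 'b::banach. x \<noteq> 0"
    and "\<alpha> > 0"
    and "1 < p"
  shows "(t1 - t0) powr \<alpha> / (Gamma (\<alpha> + 1) * (\<alpha> * p + 1) powr (1 / p))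
    \<le> Lp_opnorm (lebesgue_on {t0..t1}) p
        (RL_integral \<alpha> t0 :: (real \<Rightarrow> 'b) \<Rightarrow> real \<Rightarrow> 'b)"
proof -
  let ?M = "lebesgue_on {t0..t1}"
  define L where "L = t1 - t0"
  have L: "L > 0"
    using assms by (simp add: L_def)
  have Gamma_pos: "Gamma (\<alpha> + 1) > 0"
    using assms by (intro Gamma_real_pos) simp
  have ap: "\<alpha> * p + 1 > 0"
    using assms by (simp add: add_pos_pos)
  obtain x :: 'b where x: "x \<noteq> 0"
    using assms by blast
  \<comment> \<open>Scaled such that the constant function \<open>e\<close> has norm 1 on an interval of length \<open>L\<close>.\<close>
  define e where "e = (L powr (- 1 / p) / norm x) *\<^sub>R x"
  have norm_e: "norm e powr p = 1 / L"
    using x L assms by (simp add: e_def powr_powr powr_minus_divide powr_divide)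
  have "(LINT t|?M. norm e powr p) = 1"
    using L norm_e by (simp add: measure_restrict_space L_def)
  then have unit: "Lp_norm ?M p (\<lambda>_. e) \<le> 1"
    by (simp add: Lp_norm_def)
  have "((\<lambda>t. (t - t0) powr (\<alpha> * p)) has_integral L powr (\<alpha> * p + 1) / (\<alpha> * p + 1)) {t0..t1}"
    using has_integral_powr_shift[of "\<alpha> * p" t0 t1] ap assms by (simp add: L_def)
  then have int: "(LINT t|?M. (t - t0) powr (\<alpha> * p)) = L powr (\<alpha> * p + 1) / (\<alpha> * p + 1)"
    by (rule integrable_lebesgue_on_has_integral) simp
  have "(LINT t|?M. norm (RL_integral \<alpha> t0 (\<lambda>_. e) t) powr p)
      = (LINT t|?M. 1 / (L * Gamma (\<alpha> + 1) powr p) * (t - t0) powr (\<alpha> * p))"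
    using assms Gamma_pos
    by (intro Bochner_Integration.integral_cong refl)
       (simp add: RL_integral_const powr_mult powr_divide powr_powr norm_e)
  also have "\<dots> = L powr (\<alpha> * p) / (Gamma (\<alpha> + 1) powr p * (\<alpha> * p + 1))"
    using L by (simp add: int powr_add)
  finally have "Lp_norm ?M p (RL_integral \<alpha> t0 (\<lambda>_. e))
      = (L powr (\<alpha> * p) / (Gamma (\<alpha> + 1) powr p * (\<alpha> * p + 1))) powr (1 / p)"
    by (simp add: Lp_norm_def)
  also have "\<dots> = L powr \<alpha> / (Gamma (\<alpha> + 1) * (\<alpha> * p + 1) powr (1 / p))"
    using L Gamma_pos ap assms by (simp add: powr_divide powr_mult powr_powr)
  finally have "L powr \<alpha> / (Gamma (\<alpha> + 1) * (\<alpha> * p + 1) powr (1 / p))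
      = Lp_norm ?M p (RL_integral \<alpha> t0 (\<lambda>_. e))" ..
  also have "\<dots> \<le> Lp_opnorm ?M p (RL_integral \<alpha> t0 :: (real \<Rightarrow> 'b) \<Rightarrow> real \<Rightarrow> 'b)"
    \<comment> \<open>On an unbounded set the supremum would be unspecified; this is where boundedness enters.\<close>
    unfolding Lp_opnorm_def
    using bdd_above_RL_integral_unit_ball[of \<alpha> p t0 t1, where 'b='b] assms const_in_Lp_set unit
    by (intro cSUP_upper) auto
  finally show ?thesis
    by (simp add: L_def)
qed

end
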